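(* Let $f(q)=\sum_{m=0}^n q^m a_m$ be a non-constant slice-regular polynomial whose twistor transform $G_f$ is planar, and let $r=\dim_{\mathbb R}\mathrm{span}_{\mathbb R}\{a_1,\dots,a_n\}$ (so $r\le 3$). (i) If $r=3$, then $G_f$ is contained in a unique hyperplane section, and this unique hyperplane section is of type $A_-$. Hence $f$ has a unique planar type. (ii) If $r\le2$, then $G_f$ is contained in more than one hyperplane section. In fact, the same polynomial $f$ is simultaneously $A_-$-planar, $A_{Q\smallsetminus N}$-planar and $A_{\mathrm{nd}}$-planar. In particular, $f$ has no unique planar type.
   Context: $\mathbb H$ denotes the quaternions and $\mathbb S=\{q\in\mathbb H: q^2=-1\}$. Fix $i,j\in\mathbb S$ with $ij=-ji$, and put $\mathbb C:=\mathbb R+\mathbb R i\subset\mathbb H$, $\mathbb C^+:=\{x+yi:y>0\}$. Every quaternion is uniquely $z+wj$ with $z,w\in\mathbb C$. Let $\Omega\subset\mathbb H$ be a symmetric slice domain: a domain with $\Omega\cap\mathbb R\ne\emptyset$, with $\Omega\cap(\mathbb R+\mathbb R I)$ a domain for all $I\in\mathbb S$, and such that $x+yI\in\Omega$ implies $x+yI'\in\Omega$ for all $I,I'\in\mathbb S$. Put $V:=\Omega\cap\mathbb C^+$. Polynomials $\sum q^ma_m$ ($a_m\in\mathbb H$) are regarded as slice-regular functions on $\Omega$. Write $f(z)=g(z)+h(z)j$ for $z\in\Omega\cap\mathbb C$, with $g,h$ holomorphic and $\mathbb C$-valued, and $\hat g(z)=\overline{g(\overline z)}$, $\hat h(z)=\overline{h(\overline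 z)}$. The twistor transform of $f$ is the holomorphic curve $G_f:V\to\mathrm{Gr}_2(\mathbb C^4)\subset\mathbb P(\Lambda^2\mathbb C^4)\cong\mathbb{CP}^5$, $$G_f(v)=[g(v)\hat g(v)+h(v)\hat h(v):h(v):-g(v):\hat g(v):\hat h(v):1],$$ in homogeneous coordinates $[\zeta_1:\dots:\zeta_6]$ with respect to the basis $e_3\wedge e_4,\,-e_2\wedge e_4,\,e_2\wedge e_3,\,e_1\wedge e_4,\,-e_1\wedge e_3,\,e_1\wedge e_2$; here $\mathrm{Gr}_2(\mathbb C^4)$ is the quadric $\zeta_1\zeta_6-\zeta_2\zeta_5+\zeta_3\zeta_4=0$. For $0\neq z\in\mathbb C^6$ the hyperplane section is $X_z:=\mathrm{Gr}_2(\mathbb C^4)\cap\{[\zeta]:\sum_k z_k\zeta_k=0\}$, and $G_f$ is planar if $G_f(V)\subset X_z$ for some $z\ne0$. For $A\subset(\mathbb{CP}^5)^\vee$, $X_z$ is of type $A$ if $[z]\in A$, and $f$ is called $A$-planar if $G_f(V)\subset X_z$ for some $[z]\in A$. Types: let $\mathrm{GL}(2,\mathbb H)\subset\mathrm{GL}(4,\mathbb C)$ be the group of invertible block matrices whose four $2\times2$ blocks have the form $\begin{pmatrix} z & -\overline w \\ w & \overline z \end{pmatrix}$, $G=\mathrm{PGL}(2,\mathbb H)=\mathrm{GL}(2,\mathbb H)/\mathbb R^\times$, acting on $\mathbb P(\Lambda^2\mathbb C^4)$ via $T\cdot[u\wedge v]=[Tu\wedge Tv]$. Let $\kappa:\mathbb{CP}^5\to(\mathbb{CP}^5)^\vee$,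 $\kappa[p_1:\dots:p_6]=[p_6:-p_5:p_4:p_3:-p_2:p_1]$. Then $A_-:=\kappa(G\cdot[1:0:0:0:0:-1])$, $A_{Q\smallsetminus N}:=\kappa(G\cdot[-1:0:-i:i:0:1])$, $A_{\mathrm{nd}}:=\kappa\big(\bigcup_{0<\lambda<1}G\cdot[-1:0:-i\lambda:i\lambda:0:1]\big)$. *)

theory Defs
  imports "HOL-Analysis.Analysis" "HOL-Library.Disjoint_Sets"
begin

section \<open>The quaternions\<close>

datatype quat = Quat (qre: real) (qim1: real) (qim2: real) (qim3: real)

lemma quat_eq_iff:
  "p = q \<longleftrightarrow> qre p = qre q \<and> qim1 p = qim1 q \<and> qim2 p = qim2 q \<and> qim3 p = qim3 q"
  by (cases p; cases q) simp

instantiation quat :: "{ring_1, real_vector}"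
begin

definition "0 = Quat 0 0 0 0"
definition "1 = Quat 1 0 0 0"
definition "p + q = Quat (qre p + qre q) (qim1 p + qim1 q) (qim2 p + qim2 q) (qim3 p + qim3 q)"
definition "p - q = Quat (qre p - qre q) (qim1 p - qim1 q) (qim2 p - qim2 q) (qim3 p - qim3 q)"
definition "- q = Quat (- qre q) (- qim1 q) (- qim2 q) (- qim3 q)"
definition "p * q = Quat
  (qre p * qre q - qim1 p * qim1 q - qim2 p * qim2 q - qim3 p * qim3 q)
  (qre p * qim1 q + qim1 p * qre q + qim2 p * qim3 q - qim3 p * qim2 q)
  (qre p * qim2 q - qim1 p * qim3 q + qim2 p * qre q + qim3 p * qim1 q)
  (qre p * qim3 q + qim1 p * qim2 q - qim2 p * qim1 q + qim3 p * qre q)"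
definition "scaleR r q = Quat (r * qre q) (r * qim1 q) (r * qim2 q) (r * qim3 q)"

instance
  by standard
    (simp_all add: quat_eq_iff zero_quat_def one_quat_def plus_quat_def minus_quat_def
      uminus_quat_def times_quat_def scaleR_quat_def algebra_simps)

end

lemmas quat_ops_def = zero_quat_def one_quat_def plus_quat_def minus_quat_def
  uminus_quat_def times_quat_def scaleR_quat_def

instantiation quat :: real_normed_div_algebra
begin

definition "norm q = sqrt ((qre q)\<^sup>2 + (qim1 q)\<^sup>2 + (qim2 q)\<^sup>2 + (qim3 q)\<^sup>2)"
definition sgn_quat_def: "sgn q = q /\<^sub>R norm q" for q :: quat
definition dist_quat_def: "dist p q = norm (p - q)" for p q :: quat
definition uniformity_quat_def [code del]:
  "(uniformity :: (quat \<times> quat) filter) = (INF e\<in>{0 <..}. principal {(x, y). dist x y < e})"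
definition open_quat_def [code del]:
  "open (U :: quat set) \<longleftrightarrow> (\<forall>x\<in>U. eventually (\<lambda>(x', y). x' = x \<longrightarrow> y \<in> U) uniformity)"
definition "inverse q = (let s = (qre q)\<^sup>2 + (qim1 q)\<^sup>2 + (qim2 q)\<^sup>2 + (qim3 q)\<^sup>2 in
  Quat (qre q / s) (- qim1 q / s) (- qim2 q / s) (- qim3 q / s))"
definition "p div q = p * inverse q" for p q :: quat

lemma norm_quat_as_pair:
  "norm q = norm (Complex (qre q) (qim1 q), Complex (qim2 q) (qim3 q))"
  by (simp add: norm_quat_def norm_Pair cmod_def)

lemma quat_sumsq_eq_0:
  "(qre q)\<^sup>2 + (qim1 q)\<^sup>2 + (qim2 q)\<^sup>2 + (qim3 q)\<^sup>2 = 0 \<longleftrightarrow> q = 0"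
  by (simp add: quat_eq_iff zero_quat_def add_nonneg_eq_0_iff)

instance
proof
  fix r :: real and p q :: quat
  show "norm q = 0 \<longleftrightarrow> q = 0"
    using quat_sumsq_eq_0[of q] by (simp add: norm_quat_def)
  show "norm (p + q) \<le> norm p + norm q"
    using norm_triangle_ineq[of "(Complex (qre p) (qim1 p), Complex (qim2 p) (qim3 p))"
        "(Complex (qre q) (qim1 q), Complex (qim2 q) (qim3 q))"]
    by (simp add: norm_quat_as_pair plus_quat_def complex_add)
  show "norm (scaleR r q) = \<bar>r\<bar> * norm q"
    by (simp add: norm_quat_def scaleR_quat_def power_mult_distrib real_sqrt_mult
        flip: distrib_left)
  show "norm (p * q) = norm p * norm q"
    unfolding norm_quat_def real_sqrt_mult[symmetric]
    by (simp add: times_quat_def power2_eq_square algebra_simps)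
  show "scaleR r p * q = scaleR r (p * q)" "p * scaleR r q = scaleR r (p * q)"
    by (simp_all add: quat_eq_iff times_quat_def scaleR_quat_def algebra_simps)
  show "p div q = p * inverse q" by (rule divide_quat_def)
  show "inverse (0::quat) = 0" by (simp add: inverse_quat_def zero_quat_def)
  { assume "q \<noteq> 0"
    define s where "s = (qre q)\<^sup>2 + (qim1 q)\<^sup>2 + (qim2 q)\<^sup>2 + (qim3 q)\<^sup>2"
    have s: "s \<noteq> 0" using \<open>q \<noteq> 0\<close> quat_sumsq_eq_0[of q] by (simp add: s_def)
    have inv: "inverse q = Quat (qre q / s) (- qim1 q / s) (- qim2 q / s) (- qim3 q / s)"
      by (simp add: inverse_quat_def s_def Let_def)
    have ss: "qre q * qre q + qim1 q * qim1 q + qim2 q * qim2 q + qim3 q * qim3 q = s"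
      by (simp add: s_def power2_eq_square)
    show "inverse q * q = 1" "q * inverse q = 1"
      using s ss by (simp_all add: inv quat_eq_iff times_quat_def one_quat_def algebra_simps
          flip: add_divide_distrib) }
qed (rule sgn_quat_def dist_quat_def open_quat_def uniformity_quat_def)+

end

definition imag_units :: "quat set"  (\<open>\<S>\<close>) where
  "\<S> = {q. q\<^sup>2 = -1}"

definition slice_emb :: "quat \<Rightarrow> complex \<Rightarrow> quat" where
  "slice_emb I z = of_real (Re z) + of_real (Im z) * I"

definition symmetric_slice_domain :: "quat set \<Rightarrow> bool" where
  "symmetric_slice_domain \<Omega> \<longleftrightarrow>
     open \<Omega> \<and> connected \<Omega> \<and> \<Omega> \<inter> range of_real \<noteq> {} \<and>
     (\<forall>I\<in>\<S>. openin (top_of_set (range (slice_emb I))) (\<Omega> \<inter> range (slice_emb I)) \<and>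
             connected (\<Omega> \<inter> range (slice_emb I))) \<and>
     (\<forall>x y. \<forall>I\<in>\<S>. \<forall>I'\<in>\<S>. of_real x + of_real y * I \<in> \<Omega> \<longrightarrow> of_real x + of_real y * I' \<in> \<Omega>)"

definition quat_poly :: "nat \<Rightarrow> (nat \<Rightarrow> quat) \<Rightarrow> quat \<Rightarrow> quat" where
  "quat_poly n a q = (\<Sum>m\<le>n. q ^ m * a m)"

definition anticommuting_units :: "quat \<Rightarrow> quat \<Rightarrow> bool" where
  "anticommuting_units i j \<longleftrightarrow> i \<in> \<S> \<and> j \<in> \<S> \<and> i * j = - (j * i)"

definition quat_split :: "quat \<Rightarrow> quat \<Rightarrow> quat \<Rightarrow> complex \<times> complex" where
  "quat_split i j q = (THE (z, w). q = slice_emb i z + slice_emb i w * j)"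

lemma slice_emb_linear: "linear (slice_emb I)"
  by (rule linearI)
    (simp_all add: slice_emb_def quat_eq_iff of_real_def quat_ops_def algebra_simps)

lemma slice_emb_mult:
  assumes "I \<in> \<S>"
  shows "slice_emb I (z * w) = slice_emb I z * slice_emb I w"
proof -
  have "I * I = -1" using assms by (simp add: imag_units_def power2_eq_square)
  then show ?thesis
    by (simp add: slice_emb_def of_real_def distrib_left distrib_right scaleR_left.add
        scaleR_left.diff scaleR_right_distrib scaleR_right_diff_distrib mult.commute)
qed

lemma imag_unitsD:
  assumes "I \<in> \<S>"
  shows "qre I = 0" "qim1 I * qim1 I + qim2 I * qim2 I + qim3 I * qim3 I = 1"
proof -
  let ?a = "qre I" and ?b = "qim1 I" and ?c = "qim2 I" and ?d = "qim3 I"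
  have e: "?a * ?a - ?b * ?b - ?c * ?c - ?d * ?d = -1" "?a * ?b = 0" "?a * ?c = 0" "?a * ?d = 0"
    using assms by (auto simp add: imag_units_def power2_eq_square quat_eq_iff quat_ops_def)
  show "?a = 0"
  proof (rule ccontr)
    assume "?a \<noteq> 0"
    then have "?a * ?a = -1" using e by simp
    then show False by (smt (verit) zero_le_square)
  qed
  then show "?b * ?b + ?c * ?c + ?d * ?d = 1" using e by simp
qed

lemma centralizer_imag_unit:
  assumes "I \<in> \<S>" "q * I = I * q"
  shows "\<exists>z. q = slice_emb I z"
proof -
  let ?b = "qim1 I" and ?c = "qim2 I" and ?d = "qim3 I"
  let ?x = "qim1 q" and ?y = "qim2 q" and ?w = "qim3 q"
  note u = imag_unitsD[OF assms(1)]
  have c: "?x * ?c = ?y * ?b" "?y * ?d = ?w * ?c" "?x * ?d = ?w * ?b"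
    using assms(2) by (auto simp: quat_eq_iff quat_ops_def u algebra_simps)
  let ?t = "?x * ?b + ?y * ?c + ?w * ?d"
  have "?x = ?t * ?b" "?y = ?t * ?c" "?w = ?t * ?d"
    using c u(2) by algebra+
  then have "q = slice_emb I (Complex (qre q) ?t)"
    by (simp add: slice_emb_def quat_eq_iff of_real_def quat_ops_def u)
  then show ?thesis ..
qed

lemma slice_emb_eq_0: "I \<in> \<S> \<Longrightarrow> slice_emb I z = 0 \<longleftrightarrow> z = 0"
proof
  assume I: "I \<in> \<S>" and z: "slice_emb I z = 0"
  note u = imag_unitsD[OF I]
  have "Re z = 0" "Im z * qim1 I = 0" "Im z * qim2 I = 0" "Im z * qim3 I = 0"
    using z by (auto simp: slice_emb_def quat_eq_iff of_real_def quat_ops_def u)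
  moreover from this have "Im z = 0" using u(2) by auto
  ultimately show "z = 0" by (simp add: complex_eq_iff)
qed (simp add: slice_emb_def)

lemma slice_emb_commute: "slice_emb I z * I = I * slice_emb I z"
  by (simp add: slice_emb_def of_real_def algebra_simps)

lemma ex1_quat_split:
  assumes "anticommuting_units i j"
  shows "\<exists>!p. q = slice_emb i (fst p) + slice_emb i (snd p) * j"
proof -
  have i: "i \<in> \<S>" and j: "j \<in> \<S>" and ij: "i * j = - (j * i)"
    using assms by (auto simp: anticommuting_units_def)
  have ii: "i * i = -1" and jj: "j * j = -1"
    using i j by (simp_all add: imag_units_def power2_eq_square)
  have iix: "i * (i * x) = - x" and jjx: "j * (j * x) = - x" for x
    by (simp_all add: ii jj flip: mult.assoc)
  define A where "A = (1/2) *\<^sub>R (q - i * q * i)"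
  define B where "B = (1/2) *\<^sub>R (q + i * q * i)"
  have "A * i = i * A" by (simp add: A_def algebra_simps iix ii)
  then obtain z where z: "A = slice_emb i z" using centralizer_imag_unit i by blast
  have Bi: "B * i = - (i * B)" by (simp add: B_def algebra_simps iix ii)
  have "(- (B * j)) * i = i * (- (B * j))"
  proof -
    have "(- (B * j)) * i = B * (i * j)" by (simp add: ij mult.assoc)
    also have "\<dots> = (B * i) * j" by (simp add: mult.assoc)
    finally show ?thesis by (simp add: Bi mult.assoc)
  qed
  then obtain w where w: "- (B * j) = slice_emb i w" using centralizer_imag_unit i by blast
  have "slice_emb i w * j = B" by (simp add: mult.assoc jj flip: w)
  moreover have "q = A + B" by (simp add: A_def B_def algebra_simps flip: scaleR_add_left)
  ultimately have q: "q = slice_emb i z + slice_emb i w * j" by (simp add: z)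
  have zero: "x = 0 \<and> y = 0" if e: "slice_emb i x + slice_emb i y * j = 0" for x y
  proof -
    let ?X = "slice_emb i x" and ?Y = "slice_emb i y"
    have X: "?X = - (?Y * j)" using e by (simp add: eq_neg_iff_add_eq_0)
    have "?Y * (j * i) = ?Y * (i * j)"
    proof -
      have "?Y * (j * i) = - (?X * i)" by (simp add: X mult.assoc)
      also have "\<dots> = - (i * ?X)" by (simp add: slice_emb_commute)
      also have "\<dots> = (i * ?Y) * j" by (simp add: X mult.assoc)
      finally show ?thesis by (simp add: mult.assoc flip: slice_emb_commute)
    qed
    then have "?Y * (i * j) = - (?Y * (i * j))" by (simp add: ij)
    then have "(2::real) *\<^sub>R (?Y * (i * j)) = 0" by (simp add: scaleR_2 eq_neg_iff_add_eq_0)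
    moreover have "i \<noteq> 0" "j \<noteq> 0" using ii jj by auto
    ultimately have "?Y = 0" by simp
    then show ?thesis using X slice_emb_eq_0[OF i, of x] slice_emb_eq_0[OF i, of y] by auto
  qed
  show ?thesis
  proof (rule ex1I[of _ "(z, w)"])
    fix p assume p: "q = slice_emb i (fst p) + slice_emb i (snd p) * j"
    have "slice_emb i (fst p - z) + slice_emb i (snd p - w) * j = 0"
      using p q by (simp add: linear_diff[OF slice_emb_linear] algebra_simps)
    then show "p = (z, w)" using zero by (fastforce simp: prod_eq_iff)
  qed (simp add: q)
qed

lemma quat_split_eqI:
  assumes "anticommuting_units i j" "q = slice_emb i z + slice_emb i w * j"
  shows "quat_split i j q = (z, w)"
proof -
  have "\<exists>!p. case p of (z, w) \<Rightarrow> q = slice_emb i z + slice_emb i w * j"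
    using ex1_quat_split[OF assms(1), of q] by (simp add: case_prod_unfold)
  then show ?thesis
    unfolding quat_split_def using assms(2) by (intro the1_equality) auto
qed


section \<open>The Klein quadric and its hyperplane sections\<close>

text \<open>A point of \<open>\<complex>\<P>\<^sup>5\<close> (or of its dual) is the set of all its homogeneous coordinate vectors,
  so that the bijective linear maps \<open>ext2_map T\<close> and \<open>kappa_vec\<close> below act on points by image.\<close>

type_synonym point5 = "(complex ^ 6) set"

definition proj :: "complex ^ 6 \<Rightarrow> point5" where
  "proj \<zeta> = {c *s \<zeta> | c. c \<noteq> 0}"

definition Gr2 :: "point5 set" where
  "Gr2 = {proj \<zeta> | \<zeta>. \<zeta> \<noteq> 0 \<and> \<zeta>$1 * \<zeta>$6 - \<zeta>$2 * \<zeta>$5 + \<zeta>$3 * \<zeta>$4 = 0}"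

definition hyperplane_section :: "complex ^ 6 \<Rightarrow> point5 set" where
  "hyperplane_section z = Gr2 \<inter> {proj \<zeta> | \<zeta>. \<zeta> \<noteq> 0 \<and> (\<Sum>k\<in>UNIV. z$k * \<zeta>$k) = 0}"

definition hyperplane_sections :: "point5 set set" where
  "hyperplane_sections = {hyperplane_section z | z. z \<noteq> 0}"

text \<open>\<open>\<Lambda>\<^sup>2\<complex>\<^sup>4\<close> in coordinates with respect to the basis
  \<open>e\<^sub>3 \<and> e\<^sub>4, -e\<^sub>2 \<and> e\<^sub>4, e\<^sub>2 \<and> e\<^sub>3, e\<^sub>1 \<and> e\<^sub>4, -e\<^sub>1 \<and> e\<^sub>3, e\<^sub>1 \<and> e\<^sub>2\<close>.\<close>

definition wedge :: "complex ^ 4 \<Rightarrow> complex ^ 4 \<Rightarrow> complex ^ 6" where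
  "wedge u v = vector
     [u$3 * v$4 - u$4 * v$3, - (u$2 * v$4 - u$4 * v$2), u$2 * v$3 - u$3 * v$2,
      u$1 * v$4 - u$4 * v$1, - (u$1 * v$3 - u$3 * v$1), u$1 * v$2 - u$2 * v$1]"

text \<open>The induced map \<open>\<Lambda>\<^sup>2 T\<close>; note \<^prop>\<open>column k T = T *v axis k 1\<close>.\<close>

definition ext2_map :: "complex ^ 4 ^ 4 \<Rightarrow> complex ^ 6 \<Rightarrow> complex ^ 6" where
  "ext2_map T \<zeta> =
       \<zeta>$1 *s wedge (column 3 T) (column 4 T) - \<zeta>$2 *s wedge (column 2 T) (column 4 T)
     + \<zeta>$3 *s wedge (column 2 T) (column 3 T) + \<zeta>$4 *s wedge (column 1 T) (column 4 T)
     - \<zeta>$5 *s wedge (column 1 T) (column 3 T) + \<zeta>$6 *s wedge (column 1 T) (column 2 T)"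

lemma exhaust_6: fixes x :: 6 shows "x = 1 \<or> x = 2 \<or> x = 3 \<or> x = 4 \<or> x = 5 \<or> x = 6"
proof (induct x)
  case (of_int z)
  then have "z = 0 \<or> z = 1 \<or> z = 2 \<or> z = 3 \<or> z = 4 \<or> z = 5" by fastforce
  then show ?case by auto
qed

lemma forall_6: "(\<forall>i::6. P i) \<longleftrightarrow> P 1 \<and> P 2 \<and> P 3 \<and> P 4 \<and> P 5 \<and> P 6"
  by (metis exhaust_6)

lemma vector_6 [simp]:
  "(vector [a,b,c,d,e,f] :: ('a::zero)^6)$1 = a"
  "(vector [a,b,c,d,e,f] :: ('a::zero)^6)$2 = b"
  "(vector [a,b,c,d,e,f] :: ('a::zero)^6)$3 = c"
  "(vector [a,b,c,d,e,f] :: ('a::zero)^6)$4 = d"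
  "(vector [a,b,c,d,e,f] :: ('a::zero)^6)$5 = e"
  "(vector [a,b,c,d,e,f] :: ('a::zero)^6)$6 = f"
  unfolding vector_def by simp_all

lemma ext2_map_wedge: "ext2_map T (wedge u v) = wedge (T *v u) (T *v v)"
  by (simp add: vec_eq_iff forall_6 ext2_map_def wedge_def matrix_vector_mult_def column_def sum_4)
     (simp add: algebra_simps)

definition GL2H :: "(complex ^ 4 ^ 4) set" where
  "GL2H = {T. invertible T \<and> (\<forall>p\<in>{1, 3}. \<forall>q\<in>{1, 3}.
     T$p$(q + 1) = - cnj (T$(p + 1)$q) \<and> T$(p + 1)$(q + 1) = cnj (T$p$q))}"

text \<open>Real scalars act trivially on projective space, so the \<open>PGL(2,\<bbbH>)\<close>-orbit of a point is its
  \<open>GL(2,\<bbbH>)\<close>-orbit.\<close>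

definition orbit :: "point5 \<Rightarrow> point5 set" where
  "orbit P = {ext2_map T ` P | T. T \<in> GL2H}"

definition kappa_vec :: "complex ^ 6 \<Rightarrow> complex ^ 6" where
  "kappa_vec p = vector [p$6, - p$5, p$4, p$3, - p$2, p$1]"

definition kappa :: "point5 \<Rightarrow> point5" where
  "kappa P = kappa_vec ` P"

definition A_minus :: "point5 set" where
  "A_minus = kappa ` orbit (proj (vector [1, 0, 0, 0, 0, -1]))"

definition A_QN :: "point5 set" where
  "A_QN = kappa ` orbit (proj (vector [-1, 0, -\<i>, \<i>, 0, 1]))"

definition A_nd :: "point5 set" where
  "A_nd = kappa ` (\<Union>l\<in>{0<..<1::real}.
     orbit (proj (vector [-1, 0, -\<i> * of_real l, \<i> * of_real l, 0, 1])))"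


section \<open>The twistor transform and planarity\<close>

text \<open>\<open>\<Omega> \<inter> \<complex>\<^sup>+\<close>, with \<open>\<real> + \<real>i\<close> identified with the complex numbers.\<close>

definition upper_slice :: "quat \<Rightarrow> quat set \<Rightarrow> complex set" where
  "upper_slice i \<Omega> = {v. Im v > 0 \<and> slice_emb i v \<in> \<Omega>}"

definition twistor_transform :: "quat \<Rightarrow> quat \<Rightarrow> (quat \<Rightarrow> quat) \<Rightarrow> complex \<Rightarrow> point5" where
  "twistor_transform i j f v =
     (let g = (\<lambda>z. fst (quat_split i j (f (slice_emb i z))));
          h = (\<lambda>z. snd (quat_split i j (f (slice_emb i z))));
          g' = (\<lambda>z. cnj (g (cnj z)));
          h' = (\<lambda>z. cnj (h (cnj z)))
      in proj (vector [g v * g' v + h v * h' v, h v, - g v, g' v, h' v, 1]))"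

definition twistor_curve :: "quat \<Rightarrow> quat \<Rightarrow> quat set \<Rightarrow> (quat \<Rightarrow> quat) \<Rightarrow> point5 set" where
  "twistor_curve i j \<Omega> f = twistor_transform i j f ` upper_slice i \<Omega>"

definition planar :: "quat \<Rightarrow> quat \<Rightarrow> quat set \<Rightarrow> (quat \<Rightarrow> quat) \<Rightarrow> bool" where
  "planar i j \<Omega> f \<longleftrightarrow> (\<exists>z. z \<noteq> 0 \<and> twistor_curve i j \<Omega> f \<subseteq> hyperplane_section z)"

definition type_planar ::
    "point5 set \<Rightarrow> quat \<Rightarrow> quat \<Rightarrow> quat set \<Rightarrow> (quat \<Rightarrow> quat) \<Rightarrow> bool" where
  "type_planar A i j \<Omega> f \<longleftrightarrow>
     (\<exists>z. z \<noteq> 0 \<and> proj z \<in> A \<and> twistor_curve i j \<Omega> f \<subseteq> hyperplane_section z)"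

text \<open>\<open>\<T>\<close> is the family of subsets of the dual space that are regarded as types. It is a parameter
  because a type is only required to be a subset \<open>A\<close>: with all subsets allowed, uniqueness would always
  fail, so it is meaningful only relative to a family of pairwise disjoint types.\<close>

definition unique_planar_type ::
    "point5 set set \<Rightarrow> quat \<Rightarrow> quat \<Rightarrow> quat set \<Rightarrow> (quat \<Rightarrow> quat) \<Rightarrow> bool" where
  "unique_planar_type \<T> i j \<Omega> f \<longleftrightarrow> (\<exists>!A. A \<in> \<T> \<and> type_planar A i j \<Omega> f)"

end

theory Submission
  imports Defs
begin

text \<open>On the slice, \<open>f = g + h j\<close>, so the coefficients are the pairs \<open>p m = quat_split i j (a m)\<close> in
  \<open>\<complex> \<times> \<complex> = \<real>\<^sup>4\<close>, and incidence of the twistor curve with a hyperplane \<open>z\<close> is a polynomial identity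
  in one variable. If \<open>N\<close> is the degree of \<open>f\<close>, the term \<open>z\<^sub>1 (g g' + h h')\<close> contributes
  \<open>z\<^sub>1 \<bar>a\<^sub>N\<bar>\<^sup>2\<close> in degree \<open>2 N > N\<close> and nothing else reaches this degree, whence \<open>z\<^sub>1 = 0\<close>
  (\<open>pairing_vanishes_imp_first_0\<close>). What is left is linear in \<open>f\<close>: the coordinates \<open>z\<^sub>2, \<dots>, z\<^sub>5\<close> are a
  complex-valued real-linear functional \<open>2 (b \<bullet> \<cdot>) + 2 \<i> (c \<bullet> \<cdot>)\<close> on the quaternions, which must kill
  \<open>a\<^sub>1, \<dots>, a\<^sub>n\<close>, and \<open>z\<^sub>6\<close> is then dictated by \<open>a\<^sub>0\<close> (\<open>twistor_curve_subset_iff_plane_vec\<close>). The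
  hyperplanes through the curve are therefore the pairs \<open>(b, c)\<close> of vectors in the orthogonal complement
  of the coefficients, a real vector space of dimension \<open>4 - r\<close>.

  If \<open>r = 3\<close>, this complement is a line, so \<open>b\<close> and \<open>c\<close> are real multiples of one vector and all these
  \<open>z\<close> are complex multiples of a single one. If \<open>r \<le> 2\<close>, the complement contains an orthonormal pair
  \<open>b, c\<close>, and the functionals with coefficients \<open>b\<close> and \<open>l *\<^sub>R c\<close> sweep out the types: \<open>l = 0\<close> is
  \<open>A_minus\<close>, \<open>l = 1\<close> is \<open>A_QN\<close>, and \<open>0 < l < 1\<close> lies in \<open>A_nd\<close>.

  The link between functionals and types has two halves. Every orthonormal pair comes from the normal
  form of its orbit by one explicit quaternionic matrix, the same for all \<open>l\<close>
  (\<open>dual_vec_in_type\<close>). In the other direction the types are distinguished by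
  the real structure \<open>j \<otimes> j\<close> on the second exterior power, with which the group commutes: the points of
  \<open>A_minus\<close> are real, while those of \<open>A_QN\<close> and \<open>A_nd\<close> are not (\<open>orbit_base_vec_disjoint\<close>).\<close>

section \<open>Points and hyperplane sections of the Klein quadric\<close>

lemma proj_eqD: "proj x = proj y \<Longrightarrow> \<exists>c. c \<noteq> 0 \<and> x = c *s y"
proof -
  assume e: "proj x = proj y"
  have "x \<in> proj x" unfolding proj_def by (rule CollectI, rule exI[of _ 1]) simp
  then show ?thesis using e by (auto simp: proj_def)
qed

lemma proj_scale: "c \<noteq> 0 \<Longrightarrow> proj (c *s x) = proj x"
proof -
  assume c: "c \<noteq> 0"
  have "k *s x = (k / c) *s (c *s x)" for k using c by simp
  then show ?thesis using c unfolding proj_def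
    by (smt (verit, best) Collect_cong divide_eq_0_iff mult_eq_0_iff vector_smult_assoc)
qed

lemma image_proj: "(\<And>c. F (c *s x) = c *s F x) \<Longrightarrow> F ` proj x = proj (F x)"
  unfolding proj_def by (auto simp: image_iff) metis

lemma proj_in_hyperplane_section_iff:
  assumes "\<zeta> \<noteq> 0"
  shows "proj \<zeta> \<in> hyperplane_section z \<longleftrightarrow>
    \<zeta>$1 * \<zeta>$6 - \<zeta>$2 * \<zeta>$5 + \<zeta>$3 * \<zeta>$4 = 0 \<and> (\<Sum>k\<in>UNIV. z$k * \<zeta>$k) = 0"
    (is "_ \<longleftrightarrow> ?Q \<zeta> \<and> ?L \<zeta>")
proof -
  have Q: "?Q (c *s y) \<longleftrightarrow> ?Q y" if "c \<noteq> 0" for c y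
  proof -
    have "(c *s y)$1 * (c *s y)$6 - (c *s y)$2 * (c *s y)$5 + (c *s y)$3 * (c *s y)$4
      = c\<^sup>2 * (y$1 * y$6 - y$2 * y$5 + y$3 * y$4)"
      by (simp add: algebra_simps power2_eq_square)
    then show ?thesis using that by simp
  qed
  have L: "?L (c *s y) \<longleftrightarrow> ?L y" if "c \<noteq> 0" for c y
  proof -
    have "(\<Sum>k\<in>UNIV. z$k * (c *s y)$k) = c * (\<Sum>k\<in>UNIV. z$k * y$k)"
      by (simp add: sum_distrib_left algebra_simps)
    then show ?thesis using that by simp
  qed
  show ?thesis
  proof
    assume "proj \<zeta> \<in> hyperplane_section z"
    then obtain x y where x: "proj \<zeta> = proj x" "?Q x" and y: "proj \<zeta> = proj y" "?L y"
      unfolding hyperplane_section_def Gr2_def by blast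
    obtain c d where c: "c \<noteq> 0" "\<zeta> = c *s x" and d: "d \<noteq> 0" "\<zeta> = d *s y"
      using proj_eqD[OF x(1)] proj_eqD[OF y(1)] by blast
    have "?Q \<zeta>" unfolding c(2) by (rule Q[THEN iffD2]) (rule c(1), rule x(2))
    moreover have "?L \<zeta>" unfolding d(2) by (rule L[THEN iffD2]) (rule d(1), rule y(2))
    ultimately show "?Q \<zeta> \<and> ?L \<zeta>" by (rule conjI)
  qed (use assms in \<open>auto simp: hyperplane_section_def Gr2_def\<close>)
qed

lemma hyperplane_section_scale:
  "c \<noteq> 0 \<Longrightarrow> hyperplane_section (c *s z) = hyperplane_section z"
  unfolding hyperplane_section_def
  by (simp add: mult.assoc flip: sum_distrib_left)

text \<open>The hyperplanes with vanishing first coordinate, written in terms of the real and imaginary parts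
  \<open>2 (b \<bullet> \<cdot>)\<close> and \<open>2 (c \<bullet> \<cdot>)\<close> of the functional that they induce on \<open>\<complex> \<times> \<complex>\<close>; \<open>s\<close> is the constant term.\<close>

definition dual_vec :: "complex \<times> complex \<Rightarrow> complex \<times> complex \<Rightarrow> complex \<Rightarrow> complex ^ 6" where
  "dual_vec b c s = vector [0, cnj (snd b) + \<i> * cnj (snd c), - (cnj (fst b) + \<i> * cnj (fst c)),
     fst b + \<i> * fst c, snd b + \<i> * snd c, s]"

definition pairing :: "complex ^ 6 \<Rightarrow> complex ^ 6 \<Rightarrow> complex" where
  "pairing z \<zeta> = (\<Sum>k\<in>UNIV. z$k * \<zeta>$k)"

lemma sum_6: "sum f (UNIV :: 6 set) = f 1 + f 2 + f 3 + f 4 + f 5 + f 6"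
proof -
  have U: "(UNIV :: 6 set) = {1, 2, 3, 4, 5, 6}"
    using exhaust_6 by auto
  show ?thesis unfolding U by (simp add: ac_simps)
qed

text \<open>The coordinates \<open>z\<^sub>2, z\<^sub>5\<close> determine \<open>snd b, snd c\<close>, and \<open>z\<^sub>3, z\<^sub>4\<close> determine \<open>fst b, fst c\<close>, because a
  complex-valued real-linear functional splits uniquely into real and imaginary parts.\<close>

lemma ex_dual_vec:
  assumes "z$1 = 0" shows "\<exists>b c. z = dual_vec b c (z$6)"
proof -
  define b where "b = ((z$4 - cnj (z$3)) / 2, (z$5 + cnj (z$2)) / 2)"
  define c where "c = ((z$4 + cnj (z$3)) / (2 * \<i>), (z$5 - cnj (z$2)) / (2 * \<i>))"
  have "z = dual_vec b c (z$6)"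
    using assms by (simp add: dual_vec_def b_def c_def vec_eq_iff forall_6 field_simps)
  then show ?thesis by blast
qed

lemma dual_vec_eq_0_iff: "dual_vec b c s = 0 \<longleftrightarrow> b = 0 \<and> c = 0 \<and> s = 0"
proof
  assume "dual_vec b c s = 0"
  then show "b = 0 \<and> c = 0 \<and> s = 0"
    by (simp add: dual_vec_def vec_eq_iff forall_6 complex_eq_iff prod_eq_iff)
qed (simp add: dual_vec_def vec_eq_iff forall_6)

section \<open>The action of GL(2,H) and its real structure\<close>

lemma ext2_map_add: "ext2_map T (x + y) = ext2_map T x + ext2_map T y"
  by (simp add: ext2_map_def vec_eq_iff algebra_simps)

lemma ext2_map_diff: "ext2_map T (x - y) = ext2_map T x - ext2_map T y"
  by (simp add: ext2_map_def vec_eq_iff algebra_simps)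

lemma ext2_map_scale: "ext2_map T (c *s x) = c *s ext2_map T x"
  by (simp add: ext2_map_def vec_eq_iff algebra_simps)

lemma column_matrix_mult: "column k (S ** T) = S *v column k T"
  by (simp add: column_def matrix_matrix_mult_def matrix_vector_mult_def vec_eq_iff)

text \<open>Functoriality: both sides are linear in \<open>x\<close> and agree on wedge products.\<close>

lemma ext2_map_mult: "ext2_map (S ** T) x = ext2_map S (ext2_map T x)"
  by (subst (3) ext2_map_def)
     (simp add: ext2_map_add ext2_map_diff ext2_map_scale ext2_map_wedge ext2_map_def[of "S ** T"]
        column_matrix_mult)

lemma ext2_map_mat_1: "ext2_map (mat 1) x = x"
  by (simp add: ext2_map_def vec_eq_iff forall_6 wedge_def column_def mat_def)

lemma inj_ext2_map:
  assumes "invertible T" shows "inj (ext2_map T)"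
proof -
  obtain S where "S ** T = mat 1" using assms by (auto simp: invertible_def)
  then have "ext2_map S (ext2_map T x) = x" for x by (metis ext2_map_mult ext2_map_mat_1)
  then show ?thesis by (metis injI)
qed

text \<open>The antilinear involution \<open>j \<otimes> j\<close> of the second exterior power, where \<open>j\<close> is the quaternionic
  structure \<open>e\<^sub>1 \<mapsto> e\<^sub>2 \<mapsto> - e\<^sub>1\<close>, \<open>e\<^sub>3 \<mapsto> e\<^sub>4 \<mapsto> - e\<^sub>3\<close>.\<close>

definition real_structure :: "complex ^ 6 \<Rightarrow> complex ^ 6" where
  "real_structure p = vector [cnj (p$1), cnj (p$5), - cnj (p$4), - cnj (p$3), cnj (p$2), cnj (p$6)]"

lemma real_structure_scale: "real_structure (c *s p) = cnj c *s real_structure p"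
  by (simp add: real_structure_def vec_eq_iff forall_6)

lemma GL2H_entries:
  assumes "T \<in> GL2H"
  shows "T$1$2 = - cnj (T$2$1)" "T$2$2 = cnj (T$1$1)" "T$1$4 = - cnj (T$2$3)" "T$2$4 = cnj (T$1$3)"
    "T$3$2 = - cnj (T$4$1)" "T$4$2 = cnj (T$3$1)" "T$3$4 = - cnj (T$4$3)" "T$4$4 = cnj (T$3$3)"
  using assms by (simp_all add: GL2H_def)

text \<open>Quaternionic matrices commute with \<open>j\<close>, hence with \<open>j \<otimes> j\<close>.\<close>

lemma real_structure_ext2_map:
  assumes "T \<in> GL2H"
  shows "real_structure (ext2_map T p) = ext2_map T (real_structure p)"
  by (simp add: real_structure_def ext2_map_def vec_eq_iff forall_6 wedge_def column_def
        GL2H_entries[OF assms]) (simp add: algebra_simps)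

lemma kappa_proj: "kappa (proj p) = proj (kappa_vec p)"
  unfolding kappa_def by (rule image_proj) (simp add: kappa_vec_def vec_eq_iff forall_6)

lemma orbit_proj: "orbit (proj p) = {proj (ext2_map T p) | T. T \<in> GL2H}"
  unfolding orbit_def by (simp add: image_proj ext2_map_scale)

lemma inj_kappa_vec: "inj kappa_vec"
  by (rule injI) (simp add: kappa_vec_def vec_eq_iff forall_6)

text \<open>One family of normal forms for the orbits of all three types. Its first term is real, its second one
  \<open>\<i> l\<close> times a real vector.\<close>

definition base_vec :: "real \<Rightarrow> complex ^ 6" where
  "base_vec l = vector [-1, 0, -\<i> * of_real l, \<i> * of_real l, 0, 1]"

lemma A_minus_eq_orbits: "A_minus = kappa ` orbit (proj (base_vec 0))"
proof -
  have "vector [1, 0, 0, 0, 0, -1] = (-1) *s base_vec 0"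
    by (simp add: base_vec_def vec_eq_iff forall_6)
  then show ?thesis unfolding A_minus_def by (metis proj_scale neg_equal_0_iff_equal zero_neq_one)
qed

lemma A_QN_eq_orbits: "A_QN = kappa ` orbit (proj (base_vec 1))"
  by (simp add: A_QN_def base_vec_def)

lemma A_nd_eq_orbits: "A_nd = kappa ` (\<Union>l\<in>{0<..<1}. orbit (proj (base_vec l)))"
  by (simp add: A_nd_def base_vec_def)

text \<open>A point in the first orbit has a real representative, so a representative and its conjugate are
  proportional. Since the group acts injectively and commutes with conjugation, the same would hold for
  \<open>base_vec l\<close>, which is proportional to its conjugate \<open>base_vec (- l)\<close> only for \<open>l = 0\<close>.\<close>

lemma orbit_base_vec_disjoint:
  assumes "l \<noteq> 0"
  shows "kappa ` orbit (proj (base_vec 0)) \<inter> kappa ` orbit (proj (base_vec l)) = {}"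
proof (rule ccontr)
  assume "\<not> ?thesis"
  then obtain S T where S: "S \<in> GL2H" and T: "T \<in> GL2H"
    and "kappa (proj (ext2_map T (base_vec l))) = kappa (proj (ext2_map S (base_vec 0)))"
    by (auto simp: orbit_proj)
  then have "proj (kappa_vec (ext2_map T (base_vec l))) = proj (kappa_vec (ext2_map S (base_vec 0)))"
    by (simp add: kappa_proj)
  then obtain c where c: "c \<noteq> 0"
    and "kappa_vec (ext2_map T (base_vec l)) = c *s kappa_vec (ext2_map S (base_vec 0))"
    using proj_eqD by blast
  moreover have "c *s kappa_vec x = kappa_vec (c *s x)" for x
    by (simp add: kappa_vec_def vec_eq_iff forall_6)
  ultimately have e: "ext2_map T (base_vec l) = c *s ext2_map S (base_vec 0)"
    using inj_kappa_vec by (simp add: inj_eq)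
  have r0: "real_structure (base_vec 0) = base_vec 0"
    by (simp add: real_structure_def base_vec_def vec_eq_iff forall_6)
  have "ext2_map T (real_structure (base_vec l)) = cnj c *s ext2_map S (base_vec 0)"
    by (metis e r0 real_structure_ext2_map[OF S] real_structure_ext2_map[OF T] real_structure_scale)
  also have "\<dots> = (cnj c / c) *s ext2_map T (base_vec l)"
    using c by (simp add: e)
  finally have "real_structure (base_vec l) = (cnj c / c) *s base_vec l"
    using inj_ext2_map[of T] T by (simp add: inj_eq GL2H_def flip: ext2_map_scale)
  then have "cnj c / c = 1" "\<i> * of_real l = (cnj c / c) * (- \<i> * of_real l)"
    by (auto simp: real_structure_def base_vec_def vec_eq_iff forall_6)
  then show False using assms by simp
qed

section \<open>An explicit quaternionic matrix reaching every orthonormal pair\<close>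

text \<open>A quaternion is given by the first column of its \<open>2 \<times> 2\<close> block.\<close>

definition quat_mat :: "complex \<times> complex \<Rightarrow> complex \<times> complex \<Rightarrow> complex \<times> complex \<Rightarrow>
    complex \<times> complex \<Rightarrow> complex ^ 4 ^ 4" where
  "quat_mat p q r s = vector
     [vector [fst p, - cnj (snd p), fst q, - cnj (snd q)],
      vector [snd p, cnj (fst p), snd q, cnj (fst q)],
      vector [fst r, - cnj (snd r), fst s, - cnj (snd s)],
      vector [snd r, cnj (fst r), snd s, cnj (fst s)]]"

lemma vector_4 [simp]:
  "(vector [a, b, c, d] :: ('a::zero) ^ 4)$1 = a"
  "(vector [a, b, c, d] :: ('a::zero) ^ 4)$2 = b"
  "(vector [a, b, c, d] :: ('a::zero) ^ 4)$3 = c"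
  "(vector [a, b, c, d] :: ('a::zero) ^ 4)$4 = d"
  unfolding vector_def by simp_all

lemma orthonormal_coords:
  fixes b c :: "complex \<times> complex"
  assumes "norm b = 1" "norm c = 1" "b \<bullet> c = 0"
  shows "fst b * cnj (fst b) + snd b * cnj (snd b) = 1"
    "fst c * cnj (fst c) + snd c * cnj (snd c) = 1"
    "fst b * cnj (fst c) + cnj (fst b) * fst c + snd b * cnj (snd c) + cnj (snd b) * snd c = 0"
proof -
  have "fst b * cnj (fst b) + snd b * cnj (snd b) = 1" if "norm b = 1" for b :: "complex \<times> complex"
  proof -
    have "(norm b)\<^sup>2 = 1" using that by simp
    then show ?thesis
      by (simp add: norm_prod_def complex_mult_cnj cmod_power2 complex_eq_iff)
  qed
  from this[OF assms(1)] this[OF assms(2)] show "fst b * cnj (fst b) + snd b * cnj (snd b) = 1"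
    "fst c * cnj (fst c) + snd c * cnj (snd c) = 1" .
  show "fst b * cnj (fst c) + cnj (fst b) * fst c + snd b * cnj (snd c) + cnj (snd b) * snd c = 0"
    using assms(3) by (simp add: complex_eq_iff inner_prod_def inner_complex_def algebra_simps)
qed

text \<open>Real vectors of the second exterior power are quaternionic Hermitian \<open>2 \<times> 2\<close> matrices \<open>M\<close>, on which
  \<open>T\<close> acts by \<open>M \<mapsto> T M T\<^sup>*\<close>. The vector \<open>base_vec l\<close> is \<open>D + \<i> l S\<close> with \<open>D\<close> the diagonal matrix with
  entries \<open>1, - 1\<close> and \<open>S\<close> the antidiagonal one with entries \<open>1, 1\<close>, and the formula lists the entries of
  \<open>T D T\<^sup>* + \<i> l T S T\<^sup>*\<close> for \<open>T\<close> with rows \<open>(1, e)\<close> and \<open>(y, z)\<close>.\<close>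

lemma ext2_map_quat_mat_base_vec:
  "ext2_map (quat_mat (1, 0) (e1, e2) (y1, y2) (z1, z2)) (base_vec l) = vector
    [y1 * cnj y1 + y2 * cnj y2 - (z1 * cnj z1 + z2 * cnj z2)
       + \<i> * of_real l * (y1 * cnj z1 + y2 * cnj z2 + z1 * cnj y1 + z2 * cnj y2),
     y2 - (z2 * cnj e1 - e2 * cnj z1) + \<i> * of_real l * (z2 + (y2 * cnj e1 - e2 * cnj y1)),
     - y1 + (z1 * cnj e1 + e2 * cnj z2) - \<i> * of_real l * (z1 + (y1 * cnj e1 + e2 * cnj y2)),
     cnj y1 - (cnj z1 * e1 + cnj e2 * z2) + \<i> * of_real l * (cnj z1 + (cnj y1 * e1 + cnj e2 * y2)),
     cnj y2 - (cnj z2 * e1 - cnj e2 * z1) + \<i> * of_real l * (cnj z2 + (cnj y2 * e1 - cnj e2 * y1)),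
     1 - (e1 * cnj e1 + e2 * cnj e2) + \<i> * of_real l * (e1 + cnj e1)]"
  by (simp add: ext2_map_def base_vec_def quat_mat_def vec_eq_iff forall_6 wedge_def column_def algebra_simps)

text \<open>In the Hermitian picture the vector that \<open>kappa_vec\<close> sends to
  \<open>dual_vec b (l *\<^sub>R c) (Complex s1 (l * s2))\<close> is \<open>B + \<i> l C\<close>, where
  \<open>B\<close> has diagonal \<open>0, s1\<close> and lower left entry \<open>- b\<close>, and \<open>C\<close> has diagonal \<open>0, s2\<close> and lower left entry
  \<open>- c\<close>. So \<open>T\<close> with rows \<open>(1, e)\<close> and \<open>(y, z)\<close> has to satisfy \<open>\<bar>e\<bar> = 1\<close>, \<open>Re e = 0\<close>,
  \<open>y - z e\<^sup>* = - b\<close>, \<open>z + y e\<^sup>* = - c\<close>, \<open>\<bar>y\<bar>\<^sup>2 - \<bar>z\<bar>\<^sup>2 = s1\<close> and \<open>2 Re (y z\<^sup>*) = s2\<close>, with \<open>*\<close> for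
  conjugation. The unit \<open>e = c\<^sup>* b\<close> is imaginary because \<open>b\<close> and \<open>c\<close> are orthogonal, and it rotates the
  pair: \<open>b e\<^sup>* = c\<close> and \<open>c e\<^sup>* = - b\<close>. So the first condition
  on \<open>y\<close> and \<open>z\<close> gives \<open>y\<close> and implies the second. With \<open>z = - t b - w c\<close> in the plane of \<open>b\<close> and \<open>c\<close>,
  the last two conditions become \<open>1 - 2 w = s1\<close> and \<open>2 t = s2\<close>.\<close>

lemma dual_vec_in_type:
  fixes b c :: "complex \<times> complex" and s1 s2 l :: real
  assumes "norm b = 1" "norm c = 1" "b \<bullet> c = 0"
  shows "proj (dual_vec b (l *\<^sub>R c) (Complex s1 (l * s2))) \<in> kappa ` orbit (proj (base_vec l))"
proof -
  define w where "w = (1 - s1) / 2"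
  define t where "t = s2 / 2"
  obtain b1 b2 c1 c2 where bc: "b = (b1, b2)" "c = (c1, c2)" by fastforce
  define e1 where "e1 = cnj c1 * b1 + cnj c2 * b2"
  define e2 where "e2 = c1 * b2 - c2 * b1"
  define y1 where "y1 = (of_real w - 1) * b1 - of_real t * c1"
  define y2 where "y2 = (of_real w - 1) * b2 - of_real t * c2"
  define z1 where "z1 = - (of_real t * b1) - of_real w * c1"
  define z2 where "z2 = - (of_real t * b2) - of_real w * c2"
  define T where "T = quat_mat (1, 0) (e1, e2) (y1, y2) (z1, z2)"
  note o = orthonormal_coords[OF assms, unfolded bc fst_conv snd_conv]
  \<comment> \<open>\<open>b e\<^sup>* = c\<close> and \<open>c e\<^sup>* = - b\<close>, each as a pair of complex equations\<close>
  have be: "b1 * cnj e1 + e2 * cnj b2 = c1" "b2 * cnj e1 - e2 * cnj b1 = c2"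
    using o(1) by (simp add: e1_def e2_def, algebra)+
  have ce: "c1 * cnj e1 + e2 * cnj c2 = - b1" "c2 * cnj e1 - e2 * cnj c1 = - b2"
    using o(2,3) by (simp add: e1_def e2_def, algebra)+
  have ee: "e1 * cnj e1 + e2 * cnj e2 = 1" "e1 + cnj e1 = 0"
    using o by (simp add: e1_def e2_def, algebra)+
  note be' = be[THEN arg_cong[of _ _ cnj], simplified] and ce' = ce[THEN arg_cong[of _ _ cnj], simplified]
  have s: "Complex s1 (l * s2) = of_real (1 - 2 * w) + \<i> * of_real l * of_real (2 * t)"
    by (simp add: complex_eq_iff w_def t_def field_simps)
  have p: "y1 * cnj y1 + y2 * cnj y2 - (z1 * cnj z1 + z2 * cnj z2) = of_real (1 - 2 * w)"
    using o unfolding y1_def y2_def z1_def z2_def by (simp, algebra)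
  have p': "y1 * cnj z1 + y2 * cnj z2 + z1 * cnj y1 + z2 * cnj y2 = of_real (2 * t)"
    using o unfolding y1_def y2_def z1_def z2_def by (simp, algebra)
  have X: "y2 - (z2 * cnj e1 - e2 * cnj z1) = - b2" "- y1 + (z1 * cnj e1 + e2 * cnj z2) = b1"
  proof -
    have "y2 - (z2 * cnj e1 - e2 * cnj z1) = y2
      + of_real t * (b2 * cnj e1 - e2 * cnj b1) + of_real w * (c2 * cnj e1 - e2 * cnj c1)"
      by (simp add: z1_def z2_def algebra_simps)
    then show "y2 - (z2 * cnj e1 - e2 * cnj z1) = - b2"
      unfolding be ce by (simp add: y2_def algebra_simps)
    have "- y1 + (z1 * cnj e1 + e2 * cnj z2) = - y1
      - of_real t * (b1 * cnj e1 + e2 * cnj b2) - of_real w * (c1 * cnj e1 + e2 * cnj c2)"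
      by (simp add: z1_def z2_def algebra_simps)
    then show "- y1 + (z1 * cnj e1 + e2 * cnj z2) = b1"
      unfolding be ce by (simp add: y1_def algebra_simps)
  qed
  have Y: "z2 + (y2 * cnj e1 - e2 * cnj y1) = - c2" "z1 + (y1 * cnj e1 + e2 * cnj y2) = - c1"
  proof -
    have "z2 + (y2 * cnj e1 - e2 * cnj y1) = z2
      + (of_real w - 1) * (b2 * cnj e1 - e2 * cnj b1) - of_real t * (c2 * cnj e1 - e2 * cnj c1)"
      by (simp add: y1_def y2_def algebra_simps)
    then show "z2 + (y2 * cnj e1 - e2 * cnj y1) = - c2"
      unfolding be ce by (simp add: z2_def algebra_simps)
    have "z1 + (y1 * cnj e1 + e2 * cnj y2) = z1
      + (of_real w - 1) * (b1 * cnj e1 + e2 * cnj b2) - of_real t * (c1 * cnj e1 + e2 * cnj c2)"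
      by (simp add: y1_def y2_def algebra_simps)
    then show "z1 + (y1 * cnj e1 + e2 * cnj y2) = - c1"
      unfolding be ce by (simp add: z1_def algebra_simps)
  qed
  note X' = X[THEN arg_cong[of _ _ cnj], simplified] and Y' = Y[THEN arg_cong[of _ _ cnj], simplified]
  have X1': "cnj y1 - (cnj z1 * e1 + cnj e2 * z2) = - cnj b1"
    using X'(2) by (simp add: algebra_simps)
  \<comment> \<open>Eliminating the upper half of \<open>x\<close> leaves the Schur complement \<open>z - y e = - c\<close>, a unit quaternion.\<close>
  have inv: "invertible T"
  proof -
    have "x = 0" if "T *v x = 0" for x
    proof -
      have x12: "x$1 = cnj e2 * x$4 - e1 * x$3" "x$2 = - e2 * x$3 - cnj e1 * x$4"
        and r: "y1 * x$1 - cnj y2 * x$2 + z1 * x$3 - cnj z2 * x$4 = 0"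
          "y2 * x$1 + cnj y1 * x$2 + z2 * x$3 + cnj z1 * x$4 = 0"
        using that
        by (simp_all add: T_def quat_mat_def vec_eq_iff forall_4 matrix_vector_mult_def sum_4
            algebra_simps eq_neg_iff_add_eq_0)
      have "c1 * x$3 - cnj c2 * x$4 = 0" "c2 * x$3 + cnj c1 * x$4 = 0"
        using r[unfolded x12] Y Y' ee(2) by (-, algebra+)
      then have "x$3 = 0" "x$4 = 0" using o(2) by (-, algebra+)
      then show ?thesis using x12 by (simp add: vec_eq_iff forall_4)
    qed
    then show ?thesis
      by (simp add: invertible_left_inverse matrix_left_invertible_ker)
  qed
  have T: "T \<in> GL2H" using inv by (simp add: GL2H_def T_def quat_mat_def)
  have eq: "dual_vec b (l *\<^sub>R c) (Complex s1 (l * s2)) = kappa_vec (ext2_map T (base_vec l))"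
    unfolding T_def ext2_map_quat_mat_base_vec p p' X Y X1' X'(1) Y' ee s
    by (simp add: bc dual_vec_def kappa_vec_def vec_eq_iff forall_6 scaleR_conv_of_real algebra_simps)
  have "kappa (proj (ext2_map T (base_vec l))) \<in> kappa ` orbit (proj (base_vec l))"
    using T by (auto simp: orbit_proj)
  then show ?thesis by (simp add: eq kappa_proj)
qed

section \<open>The twistor curve of a polynomial\<close>

definition twistor_vec :: "nat \<Rightarrow> (nat \<Rightarrow> complex \<times> complex) \<Rightarrow> complex \<Rightarrow> complex ^ 6" where
  "twistor_vec n p v =
    (let g = (\<lambda>z. \<Sum>m\<le>n. fst (p m) * z ^ m); h = (\<lambda>z. \<Sum>m\<le>n. snd (p m) * z ^ m);
         g' = (\<lambda>z. cnj (g (cnj z))); h' = (\<lambda>z. cnj (h (cnj z)))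
     in vector [g v * g' v + h v * h' v, h v, - g v, g' v, h' v, 1])"

text \<open>On the slice the powers of the variable lie in \<open>\<real> + \<real> i\<close> and stand to the left of the coefficients, so
  splitting a polynomial is splitting its coefficients.\<close>

lemma quat_split_quat_poly:
  assumes "anticommuting_units i j"
  shows "quat_split i j (quat_poly n a (slice_emb i z)) =
    (\<Sum>m\<le>n. fst (quat_split i j (a m)) * z ^ m, \<Sum>m\<le>n. snd (quat_split i j (a m)) * z ^ m)"
proof (rule quat_split_eqI[OF assms])
  have i: "i \<in> \<S>" using assms by (simp add: anticommuting_units_def)
  have a: "a m = slice_emb i (fst (quat_split i j (a m))) + slice_emb i (snd (quat_split i j (a m))) * j" for m
  proof -
    obtain p where p: "a m = slice_emb i (fst p) + slice_emb i (snd p) * j"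
      using ex1_quat_split[OF assms] by blast
    then have "quat_split i j (a m) = p" using quat_split_eqI[OF assms] by fastforce
    then show ?thesis using p by simp
  qed
  have one: "slice_emb i 1 = 1" by (simp add: slice_emb_def)
  have pow: "slice_emb i (z ^ m) = slice_emb i z ^ m" for m
    by (induction m) (simp_all add: one slice_emb_mult[OF i])
  have "slice_emb i z ^ m * a m =
      slice_emb i (fst (quat_split i j (a m)) * z ^ m)
      + slice_emb i (snd (quat_split i j (a m)) * z ^ m) * j" for m
    by (subst a) (simp add: slice_emb_mult[OF i] pow distrib_left mult.assoc
        flip: pow mult.commute[of "z ^ m"])
  then show "quat_poly n a (slice_emb i z) =
      slice_emb i (\<Sum>m\<le>n. fst (quat_split i j (a m)) * z ^ m)
      + slice_emb i (\<Sum>m\<le>n. snd (quat_split i j (a m)) * z ^ m) * j"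
    by (simp add: quat_poly_def linear_sum[OF slice_emb_linear] sum_distrib_right sum.distrib)
qed

lemma twistor_transform_quat_poly:
  assumes "anticommuting_units i j"
  shows "twistor_transform i j (quat_poly n a) v = proj (twistor_vec n (\<lambda>m. quat_split i j (a m)) v)"
  by (simp add: twistor_transform_def twistor_vec_def quat_split_quat_poly[OF assms])

lemma proj_twistor_vec_in_hyperplane_section_iff:
  "proj (twistor_vec n p v) \<in> hyperplane_section z \<longleftrightarrow> pairing z (twistor_vec n p v) = 0"
proof -
  have "twistor_vec n p v \<noteq> 0" by (auto simp: twistor_vec_def Let_def vec_eq_iff forall_6)
  then show ?thesis
    by (simp add: proj_in_hyperplane_section_iff pairing_def twistor_vec_def Let_def)
qed

lemma twistor_curve_subset_iff:
  assumes "anticommuting_units i j"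
  shows "twistor_curve i j \<Omega> (quat_poly n a) \<subseteq> hyperplane_section z \<longleftrightarrow>
    (\<forall>v\<in>upper_slice i \<Omega>. pairing z (twistor_vec n (\<lambda>m. quat_split i j (a m)) v) = 0)"
  by (auto simp: twistor_curve_def twistor_transform_quat_poly[OF assms]
      proj_twistor_vec_in_hyperplane_section_iff)

text \<open>The domain is an open set that meets the real axis, so its upper half slice contains a short vertical
  segment. This is what turns incidence along the curve into an identity of polynomials.\<close>

lemma infinite_upper_slice:
  assumes "symmetric_slice_domain \<Omega>" "i \<in> \<S>"
  shows "infinite (upper_slice i \<Omega>)"
proof -
  from assms(1) obtain x where x: "of_real x \<in> \<Omega>" and "open \<Omega>"
    by (auto simp: symmetric_slice_domain_def)
  then obtain e where e: "e > 0" "ball (of_real x) e \<subseteq> \<Omega>"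
    using open_contains_ball by blast
  have "i * i = - 1" using assms(2) by (simp add: imag_units_def power2_eq_square)
  then have "norm i * norm i = 1" by (metis norm_mult norm_minus_cancel norm_one)
  then have i: "norm i = 1" by (metis norm_ge_zero real_sqrt_mult_self real_sqrt_one abs_of_nonneg real_sqrt_abs2)
  have "Complex x t \<in> upper_slice i \<Omega>" if "t \<in> {0<..<e}" for t
  proof -
    have "dist (of_real x) (slice_emb i (Complex x t)) = t"
      using that by (simp add: slice_emb_def dist_norm norm_mult i)
    then show ?thesis using that e by (auto simp: upper_slice_def)
  qed
  then have "Complex x ` {0<..<e} \<subseteq> upper_slice i \<Omega>" by blast
  moreover have "infinite (Complex x ` {0<..<e})"
    using e(1) by (subst finite_image_iff) (auto simp: inj_on_def)
  ultimately show ?thesis using finite_subset by blast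
qed

lemma pairing_dual_vec_twistor_vec:
  "pairing (dual_vec b c s) (twistor_vec n p v) =
    s + (\<Sum>m\<le>n. (of_real (2 * (b \<bullet> p m)) + \<i> * of_real (2 * (c \<bullet> p m))) * v ^ m)"
proof -
  have inner: "of_real (2 * (b \<bullet> q)) =
      cnj (fst b) * fst q + fst b * cnj (fst q) + cnj (snd b) * snd q + snd b * cnj (snd q)"
    for b q :: "complex \<times> complex"
    by (simp add: complex_eq_iff inner_prod_def inner_complex_def algebra_simps)
  have "pairing (dual_vec b c s) (twistor_vec n p v) = s + (\<Sum>m\<le>n.
     (cnj (snd b) + \<i> * cnj (snd c)) * (snd (p m) * v ^ m)
     + (cnj (fst b) + \<i> * cnj (fst c)) * (fst (p m) * v ^ m)
     + (fst b + \<i> * fst c) * (cnj (fst (p m)) * v ^ m)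
     + (snd b + \<i> * snd c) * (cnj (snd (p m)) * v ^ m))"
    by (simp add: pairing_def sum_6 dual_vec_def twistor_vec_def Let_def cnj_sum
         sum.distrib del: minus_add_distrib flip: sum_distrib_left)
  also have "(\<lambda>m. (cnj (snd b) + \<i> * cnj (snd c)) * (snd (p m) * v ^ m)
     + (cnj (fst b) + \<i> * cnj (fst c)) * (fst (p m) * v ^ m)
     + (fst b + \<i> * fst c) * (cnj (fst (p m)) * v ^ m)
     + (snd b + \<i> * snd c) * (cnj (snd (p m)) * v ^ m))
    = (\<lambda>m. (of_real (2 * (b \<bullet> p m)) + \<i> * of_real (2 * (c \<bullet> p m))) * v ^ m)"
    unfolding inner by (simp add: algebra_simps)
  finally show ?thesis .
qed

lemma pairing_dual_vec_vanishes_iff: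
  assumes "infinite V"
  shows "(\<forall>v\<in>V. pairing (dual_vec b c s) (twistor_vec n p v) = 0) \<longleftrightarrow>
    (\<forall>m\<in>{1..n}. b \<bullet> p m = 0 \<and> c \<bullet> p m = 0) \<and>
    s = - Complex (2 * (b \<bullet> p 0)) (2 * (c \<bullet> p 0))"
proof -
  define k where "k = (\<lambda>m. (if m = 0 then s else 0) + Complex (2 * (b \<bullet> p m)) (2 * (c \<bullet> p m)))"
  have p: "pairing (dual_vec b c s) (twistor_vec n p v) = (\<Sum>m\<le>n. k m * v ^ m)" for v
  proof -
    have "(\<Sum>m\<le>n. k m * v ^ m) = (\<Sum>m\<le>n. (if m = 0 then s else 0) * v ^ m)
      + (\<Sum>m\<le>n. Complex (2 * (b \<bullet> p m)) (2 * (c \<bullet> p m)) * v ^ m)"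
      unfolding k_def distrib_right sum.distrib ..
    also have "(\<Sum>m\<le>n. (if m = 0 then s else 0) * v ^ m) = s"
      by (simp add: if_distrib[of "\<lambda>x. x * _"] sum.delta cong: if_cong)
    finally show ?thesis unfolding pairing_dual_vec_twistor_vec
      by (simp add: Complex_eq)
  qed
  have "(\<forall>v\<in>V. (\<Sum>m\<le>n. k m * v ^ m) = 0) \<longleftrightarrow> (\<forall>m\<le>n. k m = 0)"
  proof
    assume "\<forall>v\<in>V. (\<Sum>m\<le>n. k m * v ^ m) = 0"
    then have "infinite {v. (\<Sum>m\<le>n. k m * v ^ m) = 0}"
      using assms by (metis (mono_tags, lifting) mem_Collect_eq rev_finite_subset subsetI)
    then show "\<forall>m\<le>n. k m = 0" using polyfun_finite_roots[of k n] by blast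
  qed simp
  also have "\<dots> \<longleftrightarrow> k 0 = 0 \<and> (\<forall>m\<in>{1..n}. k m = 0)"
    by (auto simp: Suc_le_eq) 
  also have "k 0 = 0 \<longleftrightarrow> s = - Complex (2 * (b \<bullet> p 0)) (2 * (c \<bullet> p 0))"
    by (simp add: k_def eq_neg_iff_add_eq_0)
  also have "(\<forall>m\<in>{1..n}. k m = 0) \<longleftrightarrow> (\<forall>m\<in>{1..n}. b \<bullet> p m = 0 \<and> c \<bullet> p m = 0)"
    by (rule ball_cong) (auto simp: k_def complex_eq_iff)
  finally show ?thesis unfolding p by blast
qed

text \<open>The coefficient in degree \<open>2 N\<close>, where \<open>N \<ge> 1\<close> is the degree of the quaternionic polynomial, comes
  from the quadratic coordinate alone, and there it is the squared norm of the leading coefficient.\<close>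

lemma pairing_vanishes_imp_first_0:
  assumes "infinite V" "\<forall>v\<in>V. pairing z (twistor_vec n p v) = 0"
    and "m0 \<in> {1..n}" "p m0 \<noteq> 0"
  shows "z$1 = 0"
proof -
  define N where "N = Max {m\<in>{1..n}. p m \<noteq> 0}"
  have N: "N \<in> {m\<in>{1..n}. p m \<noteq> 0}"
    unfolding N_def by (rule Max_in) (use assms in auto)
  have top: "p m = 0" if "m \<le> n" "N < m" for m
  proof (rule ccontr)
    assume "p m \<noteq> 0"
    then have "m \<le> N" unfolding N_def using that N by (intro Max_ge) auto
    then show False using that by simp
  qed
  define P where "P = (\<lambda>F :: complex \<times> complex \<Rightarrow> complex. \<Sum>m\<le>n. monom (F (p m)) m)"
  have coeff_P: "coeff (P F) k = (if k \<le> n then F (p k) else 0)" for F k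
    by (simp add: P_def coeff_sum)
  have poly_P: "poly (P F) v = (\<Sum>m\<le>n. F (p m) * v ^ m)" for F v
    by (simp add: P_def poly_sum poly_monom)
  define G G' H H' where "G = P fst" and "G' = P (\<lambda>q. cnj (fst q))"
    and "H = P snd" and "H' = P (\<lambda>q. cnj (snd q))"
  define R where "R = smult (z$1) (G * G' + H * H') + smult (z$2) H - smult (z$3) G
    + smult (z$4) G' + smult (z$5) H' + [:z$6:]"
  have "poly R v = pairing z (twistor_vec n p v)" for v
    by (simp add: R_def pairing_def sum_6 twistor_vec_def Let_def cnj_sum poly_P G_def G'_def H_def H'_def)
  then have "V \<subseteq> {v. poly R v = 0}" using assms(2) by auto
  then have "R = 0" using assms(1) poly_roots_finite finite_subset by blast
  have top': "coeff (P F) k = 0" if "N < k" "F 0 = 0" for F k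
    using that top[of k] by (simp add: coeff_P)
  \<comment> \<open>\<open>F\<close> runs through the four coordinate functionals; all of them vanish at \<open>0\<close>, so beyond \<open>N\<close> too.\<close>
  have mult: "coeff (P F * P F') (2 * N) = F (p N) * F' (p N)" if "F 0 = 0" "F' 0 = 0" for F F'
  proof -
    have "coeff (P F * P F') (2 * N) = (\<Sum>k\<le>2*N. coeff (P F) k * coeff (P F') (2 * N - k))"
      by (rule coeff_mult)
    also have "\<dots> = (\<Sum>k\<in>{N}. coeff (P F) k * coeff (P F') (2 * N - k))"
    proof (rule sum.mono_neutral_right)
      show "\<forall>k\<in>{..2*N} - {N}. coeff (P F) k * coeff (P F') (2 * N - k) = 0"
      proof
        fix k assume "k \<in> {..2*N} - {N}"
        then have "N < k \<or> N < 2 * N - k" by auto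
        then show "coeff (P F) k * coeff (P F') (2 * N - k) = 0"
          using top' that by auto
      qed
    qed auto
    finally show ?thesis using N by (simp add: coeff_P mult_2)
  qed
  have "N < 2 * N" "2 * N \<noteq> 0" using N by auto
  then have "coeff R (2 * N) = z$1 * (fst (p N) * cnj (fst (p N)) + snd (p N) * cnj (snd (p N)))"
    by (simp add: R_def mult top' G_def G'_def H_def H'_def coeff_pCons split: nat.split)
  moreover have "fst (p N) * cnj (fst (p N)) + snd (p N) * cnj (snd (p N))
      = of_real ((cmod (fst (p N)))\<^sup>2 + (cmod (snd (p N)))\<^sup>2)"
    by (simp only: of_real_add complex_norm_square)
  moreover have "(cmod (fst (p N)))\<^sup>2 + (cmod (snd (p N)))\<^sup>2 \<noteq> 0"
    using N by (auto simp: add_nonneg_eq_0_iff prod_eq_iff)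
  ultimately show ?thesis using \<open>R = 0\<close> by (metis coeff_0 mult_eq_0_iff of_real_eq_0_iff)
qed

section \<open>Planes of coefficient functionals\<close>

text \<open>The constant term for which the hyperplane contains the point of the constant polynomial \<open>q\<close>.\<close>

definition plane_vec :: "complex \<times> complex \<Rightarrow> complex \<times> complex \<Rightarrow> complex \<times> complex \<Rightarrow> complex ^ 6" where
  "plane_vec q b c = dual_vec b c (- Complex (2 * (b \<bullet> q)) (2 * (c \<bullet> q)))"

lemma plane_vec_eq_0_iff: "plane_vec q b c = 0 \<longleftrightarrow> b = 0 \<and> c = 0"
  unfolding plane_vec_def dual_vec_eq_0_iff by (auto simp: complex_eq_iff)

text \<open>Two real functionals that are proportional over the reals combine to a complex multiple of one real
  functional; this is why \<open>r = 3\<close> forces a single, real hyperplane.\<close>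

lemma plane_vec_multiple:
  "plane_vec q (x *\<^sub>R b) (y *\<^sub>R b) = Complex x y *s plane_vec q b 0"
  by (simp add: plane_vec_def dual_vec_def vec_eq_iff forall_6 scaleR_conv_of_real complex_eq_iff)

lemma plane_vec_in_type:
  assumes "norm b = 1" "norm c = 1" "b \<bullet> c = 0"
  shows "proj (plane_vec q b (l *\<^sub>R c)) \<in> kappa ` orbit (proj (base_vec l))"
proof -
  have e: "- Complex (2 * (b \<bullet> q)) (2 * (l *\<^sub>R c \<bullet> q)) = Complex (- 2 * (b \<bullet> q)) (l * (- 2 * (c \<bullet> q)))"
    by (simp add: complex_eq_iff)
  show ?thesis unfolding plane_vec_def e by (rule dual_vec_in_type[OF assms])
qed

text \<open>The case \<open>l = 0\<close> of the normal form, up to scaling \<open>b\<close> to a unit vector and completing it to an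
  orthonormal pair by \<open>\<i> b\<close>.\<close>

lemma real_plane_vec_in_A_minus:
  assumes "b \<noteq> 0"
  shows "proj (plane_vec q b 0) \<in> A_minus"
proof -
  define b' where "b' = b /\<^sub>R norm b"
  define c where "c = (\<i> * fst b', \<i> * snd b')"
  have b': "norm b' = 1" using assms by (simp add: b'_def)
  have "norm c = norm b'" by (simp add: c_def norm_prod_def norm_mult)
  then have c: "norm c = 1" using b' by simp
  have "b' \<bullet> c = 0" by (simp add: c_def inner_prod_def inner_complex_def)
  from plane_vec_in_type[OF b' c this, of q 0] have "proj (plane_vec q b' 0) \<in> A_minus"
    by (simp add: A_minus_eq_orbits)
  moreover have "plane_vec q b 0 = Complex (norm b) 0 *s plane_vec q b' 0"
    using plane_vec_multiple[of q "norm b" b' 0] assms by (simp add: b'_def)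
  moreover have "Complex (norm b) 0 \<noteq> 0" using assms by (simp add: complex_eq_iff)
  ultimately show ?thesis by (simp add: proj_scale)
qed

text \<open>Two different hyperplanes could a priori cut the quadric in the same set. A separating point is that of
  the constant polynomial \<open>q + c\<close>: the two hyperplanes take the values \<open>2 (b \<bullet> c) = 0\<close> and
  \<open>2 (c \<bullet> c)\<close> there.\<close>

lemma hyperplane_section_plane_vec_neq:
  assumes "b \<bullet> c = 0" "c \<noteq> 0"
  shows "hyperplane_section (plane_vec q b 0) \<noteq> hyperplane_section (plane_vec q c 0)"
proof -
  define \<zeta> where "\<zeta> = twistor_vec 0 (\<lambda>_. q + c) 0"
  have e: "pairing (plane_vec q d 0) \<zeta> = of_real (2 * (d \<bullet> c))" for d
    by (simp add: \<zeta>_def plane_vec_def pairing_dual_vec_twistor_vec inner_add_right complex_eq_iff)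
  have "proj \<zeta> \<in> hyperplane_section (plane_vec q d 0) \<longleftrightarrow> d \<bullet> c = 0" for d
    using e unfolding \<zeta>_def proj_twistor_vec_in_hyperplane_section_iff by simp
  then show ?thesis using assms by (metis inner_eq_zero_iff)
qed

lemma twistor_curve_subset_iff_plane_vec:
  assumes ij: "anticommuting_units i j" and \<Omega>: "symmetric_slice_domain \<Omega>"
    and nc: "\<not> quat_poly n a constant_on \<Omega>"
  defines "p \<equiv> \<lambda>m. quat_split i j (a m)"
  shows "twistor_curve i j \<Omega> (quat_poly n a) \<subseteq> hyperplane_section z \<longleftrightarrow>
    (\<exists>b c. z = plane_vec (p 0) b c \<and> (\<forall>m\<in>{1..n}. b \<bullet> p m = 0 \<and> c \<bullet> p m = 0))"
proof -
  have inf: "infinite (upper_slice i \<Omega>)"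
    using infinite_upper_slice[OF \<Omega>] ij by (simp add: anticommuting_units_def)
  obtain m0 where m0: "m0 \<in> {1..n}" "a m0 \<noteq> 0"
  proof (rule ccontr)
    assume "\<not> thesis"
    then have "\<forall>m\<in>{1..n}. a m = 0" using that by blast
    then have "quat_poly n a q = a 0" for q
      by (simp add: quat_poly_def atMost_atLeast0 sum.atLeast_Suc_atMost)
    then show False using nc by (auto simp: constant_on_def)
  qed
  have pm0: "p m0 \<noteq> 0"
  proof
    assume "p m0 = 0"
    moreover obtain x where "a m0 = slice_emb i (fst x) + slice_emb i (snd x) * j"
      using ex1_quat_split[OF ij] by blast
    moreover from this have "p m0 = x"
      unfolding p_def using quat_split_eqI[OF ij] by fastforce
    ultimately show False using m0(2) by (simp add: slice_emb_def)
  qed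
  note z1 = pairing_vanishes_imp_first_0[where p = p, OF inf _ m0(1) pm0]
  show ?thesis
    unfolding twistor_curve_subset_iff[OF ij] p_def[symmetric]
  proof
    assume v: "\<forall>v\<in>upper_slice i \<Omega>. pairing z (twistor_vec n p v) = 0"
    obtain b c s where z: "z = dual_vec b c s" using ex_dual_vec[OF z1[OF v]] by blast
    show "\<exists>b c. z = plane_vec (p 0) b c \<and> (\<forall>m\<in>{1..n}. b \<bullet> p m = 0 \<and> c \<bullet> p m = 0)"
      using v unfolding z pairing_dual_vec_vanishes_iff[OF inf] plane_vec_def by blast
  next
    assume "\<exists>b c. z = plane_vec (p 0) b c \<and> (\<forall>m\<in>{1..n}. b \<bullet> p m = 0 \<and> c \<bullet> p m = 0)"
    then show "\<forall>v\<in>upper_slice i \<Omega>. pairing z (twistor_vec n p v) = 0"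
      unfolding plane_vec_def using pairing_dual_vec_vanishes_iff[OF inf] by blast
  qed
qed

section \<open>Dimension counting\<close>

text \<open>Splitting is a real-linear isomorphism. Its inverse is used here because the dimension of an image is
  controlled for maps out of a Euclidean space.\<close>

lemma dim_quat_split_image:
  assumes "anticommuting_units i j"
  shows "dim (quat_split i j ` S) = dim S"
proof -
  define \<psi> where "\<psi> = (\<lambda>p. slice_emb i (fst p) + slice_emb i (snd p) * j)"
  have split: "quat_split i j (\<psi> p) = p" for p
    using quat_split_eqI[OF assms] by (simp add: \<psi>_def)
  have \<psi>: "\<psi> (quat_split i j q) = q" for q
    using ex1_quat_split[OF assms, of q] split by (metis \<psi>_def)
  have "linear \<psi>"
    by (rule linearI) (simp_all add: \<psi>_def linear_add[OF slice_emb_linear]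
        linear_scale[OF slice_emb_linear] algebra_simps)
  moreover have "inj \<psi>" using split by (metis injI)
  ultimately have "dim (\<psi> ` (quat_split i j ` S)) = dim (quat_split i j ` S)"
    by (intro dim_image_eq) (auto intro: inj_on_subset)
  then show ?thesis by (simp add: image_image \<psi>)
qed

lemma orthogonal_span:
  assumes "\<forall>x\<in>P. b \<bullet> x = 0" "x \<in> span P"
  shows "b \<bullet> x = 0"
  using span_minimal[of P "{x. b \<bullet> x = 0}"] subspace_hyperplane assms by blast

text \<open>The span of \<open>P\<close> is the whole hyperplane orthogonal to \<open>b\<close>, so the component of \<open>c\<close> orthogonal to \<open>b\<close>
  lies in the span and is orthogonal to itself.\<close>

lemma orthogonal_multiple:
  fixes P :: "'a::euclidean_space set"
  assumes "dim P = DIM('a) - 1" "b \<noteq> 0"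
    and b: "\<forall>x\<in>P. b \<bullet> x = 0" and c: "\<forall>x\<in>P. c \<bullet> x = 0"
  shows "\<exists>t. c = t *\<^sub>R b"
proof -
  have "span P = {x. b \<bullet> x = 0}"
  proof (rule subspace_dim_equal)
    show "span P \<subseteq> {x. b \<bullet> x = 0}" using orthogonal_span[OF b] by blast
  qed (use assms in \<open>simp_all add: subspace_hyperplane dim_hyperplane\<close>)
  define w where "w = c - ((b \<bullet> c) / (b \<bullet> b)) *\<^sub>R b"
  have bw: "b \<bullet> w = 0" using assms(2) by (simp add: w_def inner_diff_right)
  then have "w \<in> span P" using \<open>span P = _\<close> by simp
  then have "c \<bullet> w = 0" by (rule orthogonal_span[OF c])
  then have "w \<bullet> w = 0" using bw
    by (subst (1) w_def) (simp add: inner_diff_left)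
  then show ?thesis by (auto simp: w_def)
qed

lemma ex_orthogonal:
  fixes P :: "'a::euclidean_space set"
  assumes "dim P < DIM('a)"
  obtains b where "b \<noteq> 0" "\<forall>x\<in>P. b \<bullet> x = 0"
  using lowdim_subset_hyperplane[OF assms] span_superset[of P] by blast

lemma ex_orthonormal_pair:
  fixes P :: "'a::euclidean_space set"
  assumes "dim P + 2 \<le> DIM('a)"
  obtains b c where "norm b = 1" "norm c = 1" "b \<bullet> c = 0" "\<forall>x\<in>P. b \<bullet> x = 0" "\<forall>x\<in>P. c \<bullet> x = 0"
proof -
  obtain b where b: "b \<noteq> 0" "\<forall>x\<in>P. b \<bullet> x = 0"
    using ex_orthogonal[of P] assms by auto
  have "dim (insert b P) < DIM('a)" using assms by (simp add: dim_insert)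
  then obtain c where c: "c \<noteq> 0" "\<forall>x\<in>insert b P. c \<bullet> x = 0"
    by (rule ex_orthogonal)
  show ?thesis
    by (rule that[of "b /\<^sub>R norm b" "c /\<^sub>R norm c"])
      (use b c in \<open>auto simp: inner_commute[of b c]\<close>)
qed

section \<open>Planar types of slice-regular polynomials\<close>

theorem theorem4p7:
  fixes i j :: quat and \<Omega> :: "quat set" and n r :: nat and a :: "nat \<Rightarrow> quat" and f :: "quat \<Rightarrow> quat"
  assumes "anticommuting_units i j"
    and "symmetric_slice_domain \<Omega>"
    and "f = quat_poly n a"
    and "\<not> f constant_on \<Omega>"
    and "planar i j \<Omega> f"
    and "r = dim (span (a ` {1..n}))"
  shows "r \<le> 3 \<and>
    (r = 3 \<longrightarrow>
      (\<exists>!X. X \<in> hyperplane_sections \<and> twistor_curve i j \<Omega> f \<subseteq> X) \<and>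
      (\<forall>z. z \<noteq> 0 \<and> twistor_curve i j \<Omega> f \<subseteq> hyperplane_section z \<longrightarrow> proj z \<in> A_minus) \<and>
      type_planar A_minus i j \<Omega> f \<and>
      \<not> type_planar A_QN i j \<Omega> f \<and>
      \<not> type_planar A_nd i j \<Omega> f \<and>
      (\<forall>\<T>. A_minus \<in> \<T> \<and> disjoint \<T> \<longrightarrow> unique_planar_type \<T> i j \<Omega> f)) \<and>
    (r \<le> 2 \<longrightarrow>
      (\<exists>X Y. X \<in> hyperplane_sections \<and> Y \<in> hyperplane_sections \<and> X \<noteq> Y \<and>
        twistor_curve i j \<Omega> f \<subseteq> X \<and> twistor_curve i j \<Omega> f \<subseteq> Y) \<and>
      type_planar A_minus i j \<Omega> f \<and>
      type_planar A_QN i j \<Omega> f \<and>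
      type_planar A_nd i j \<Omega> f \<and>
      (\<forall>\<T>. {A_minus, A_QN, A_nd} \<subseteq> \<T> \<longrightarrow> \<not> unique_planar_type \<T> i j \<Omega> f))"
proof -
  define p where "p = (\<lambda>m. quat_split i j (a m))"
  define P where "P = p ` {1..n}"
  let ?C = "twistor_curve i j \<Omega> f"
  let ?z = "plane_vec (p 0)"
  have r: "r = dim P"
    using dim_quat_split_image[OF assms(1), of "a ` {1..n}"]
    by (simp add: assms(6) P_def p_def image_image)
  have curve: "?C \<subseteq> hyperplane_section z \<longleftrightarrow>
      (\<exists>b c. z = ?z b c \<and> (\<forall>x\<in>P. b \<bullet> x = 0) \<and> (\<forall>x\<in>P. c \<bullet> x = 0))" for z
    using twistor_curve_subset_iff_plane_vec[OF assms(1,2), of n a z] assms(3,4)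
    unfolding P_def p_def by (auto simp: ball_conj_distrib)
  have curveI: "?C \<subseteq> hyperplane_section (?z b c)" if "\<forall>x\<in>P. b \<bullet> x = 0" "\<forall>x\<in>P. c \<bullet> x = 0" for b c
    unfolding curve using that by blast
  have disj: "A_minus \<inter> A_QN = {}" "A_minus \<inter> A_nd = {}"
  proof -
    have *: "A_minus \<inter> kappa ` orbit (proj (base_vec l)) = {}" if "l \<noteq> 0" for l
      using orbit_base_vec_disjoint[OF that] by (simp only: A_minus_eq_orbits)
    show "A_minus \<inter> A_QN = {}" unfolding A_QN_eq_orbits by (rule *) simp
    show "A_minus \<inter> A_nd = {}" unfolding A_nd_eq_orbits image_UN Int_UN_distrib
      by (rule UNION_empty_conv(2)[THEN iffD2], intro ballI *) simp
  qed

  have le3: "r \<le> 3"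
  proof -
    obtain z where "z \<noteq> 0" "?C \<subseteq> hyperplane_section z"
      using assms(5) by (auto simp: planar_def)
    then obtain b where b: "b \<noteq> 0" "\<forall>x\<in>P. b \<bullet> x = 0"
      unfolding curve using plane_vec_eq_0_iff by metis
    then have "dim P \<le> dim {x. b \<bullet> x = 0}" by (intro dim_subset) blast
    then show ?thesis using b(1) by (simp add: r dim_hyperplane)
  qed
  have case3: "(\<exists>!X. X \<in> hyperplane_sections \<and> ?C \<subseteq> X) \<and>
      (\<forall>z. z \<noteq> 0 \<and> ?C \<subseteq> hyperplane_section z \<longrightarrow> proj z \<in> A_minus) \<and>
      type_planar A_minus i j \<Omega> f \<and> \<not> type_planar A_QN i j \<Omega> f \<and> \<not> type_planar A_nd i j \<Omega> f \<and>
      (\<forall>\<T>. A_minus \<in> \<T> \<and> disjoint \<T> \<longrightarrow> unique_planar_type \<T> i j \<Omega> f)" if "r = 3"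
  proof -
    have dim: "dim P = DIM(complex \<times> complex) - 1" using \<open>r = 3\<close> r by simp
    then obtain b where b: "b \<noteq> 0" "\<forall>x\<in>P. b \<bullet> x = 0"
      using ex_orthogonal[of P] by auto
    have z0: "?z b 0 \<noteq> 0" "?C \<subseteq> hyperplane_section (?z b 0)"
      using b curveI[of b 0] by (simp_all add: plane_vec_eq_0_iff)
    have multiple: "\<exists>k. k \<noteq> 0 \<and> z = k *s ?z b 0" if z: "z \<noteq> 0" "?C \<subseteq> hyperplane_section z" for z
    proof -
      obtain b' c' where z': "z = ?z b' c'" and "\<forall>x\<in>P. b' \<bullet> x = 0" "\<forall>x\<in>P. c' \<bullet> x = 0"
        using z(2) unfolding curve by blast
      then obtain x y where "b' = x *\<^sub>R b" "c' = y *\<^sub>R b"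
        using orthogonal_multiple[OF dim b] by meson
      then have "z = Complex x y *s ?z b 0" by (simp add: z' plane_vec_multiple)
      moreover from this have "Complex x y \<noteq> 0" using z(1) by auto
      ultimately show ?thesis by blast
    qed
    have all: "proj z \<in> A_minus" if "z \<noteq> 0" "?C \<subseteq> hyperplane_section z" for z
      using multiple[OF that] real_plane_vec_in_A_minus[OF b(1), of "p 0"] by (auto simp: proj_scale)
    have minus: "type_planar A_minus i j \<Omega> f"
      using z0 all unfolding type_planar_def by blast
    have other: "\<not> type_planar A i j \<Omega> f" if "A_minus \<inter> A = {}" for A
      using all that unfolding type_planar_def by blast
    have "\<exists>!X. X \<in> hyperplane_sections \<and> ?C \<subseteq> X"
    proof (rule ex1I)
      show "hyperplane_section (?z b 0) \<in> hyperplane_sections \<and> ?C \<subseteq> hyperplane_section (?z b 0)"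
        using z0 by (auto simp: hyperplane_sections_def)
      show "X = hyperplane_section (?z b 0)" if X: "X \<in> hyperplane_sections \<and> ?C \<subseteq> X" for X
      proof -
        obtain z where z: "z \<noteq> 0" "X = hyperplane_section z" "?C \<subseteq> hyperplane_section z"
          using X by (auto simp: hyperplane_sections_def)
        then obtain k where "k \<noteq> 0" "z = k *s ?z b 0" using multiple by blast
        then show ?thesis using z(2) by (simp add: hyperplane_section_scale)
      qed
    qed
    moreover have "unique_planar_type \<T> i j \<Omega> f" if "A_minus \<in> \<T>" "disjoint \<T>" for \<T>
      unfolding unique_planar_type_def
      using that minus other by (intro ex1I[of _ A_minus]) (auto dest: disjointD)
    then have "\<forall>\<T>. A_minus \<in> \<T> \<and> disjoint \<T> \<longrightarrow> unique_planar_type \<T> i j \<Omega> f"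
      by simp
    moreover have "\<forall>z. z \<noteq> 0 \<and> ?C \<subseteq> hyperplane_section z \<longrightarrow> proj z \<in> A_minus"
      using all by simp
    ultimately show ?thesis
      using minus other[OF disj(1)] other[OF disj(2)] by (intro conjI)
  qed
  have case2: "(\<exists>X Y. X \<in> hyperplane_sections \<and> Y \<in> hyperplane_sections \<and> X \<noteq> Y \<and> ?C \<subseteq> X \<and> ?C \<subseteq> Y) \<and>
      type_planar A_minus i j \<Omega> f \<and> type_planar A_QN i j \<Omega> f \<and> type_planar A_nd i j \<Omega> f \<and>
      (\<forall>\<T>. {A_minus, A_QN, A_nd} \<subseteq> \<T> \<longrightarrow> \<not> unique_planar_type \<T> i j \<Omega> f)" if "r \<le> 2"
  proof -
    obtain b c where bc: "norm b = 1" "norm c = 1" "b \<bullet> c = 0"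
      and P: "\<forall>x\<in>P. b \<bullet> x = 0" "\<forall>x\<in>P. c \<bullet> x = 0"
    proof (rule ex_orthonormal_pair)
      show "dim P + 2 \<le> DIM(complex \<times> complex)" using \<open>r \<le> 2\<close> r by simp
    qed
    have nz: "b \<noteq> 0" "c \<noteq> 0" using bc by auto
    have contained: "?z b (l *\<^sub>R c) \<noteq> 0" "?C \<subseteq> hyperplane_section (?z b (l *\<^sub>R c))" for l
      using nz P curveI[of b "l *\<^sub>R c"] by (simp_all add: plane_vec_eq_0_iff)
    have contained': "?z c 0 \<noteq> 0" "?C \<subseteq> hyperplane_section (?z c 0)"
      using nz P curveI[of c 0] by (simp_all add: plane_vec_eq_0_iff)
    have type: "type_planar A i j \<Omega> f" if "kappa ` orbit (proj (base_vec l)) \<subseteq> A" for A l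
      unfolding type_planar_def
      using contained[of l] plane_vec_in_type[OF bc, of "p 0" l] that by blast
    have types: "type_planar A_minus i j \<Omega> f" "type_planar A_QN i j \<Omega> f" "type_planar A_nd i j \<Omega> f"
      using type[of 0 A_minus] type[of 1 A_QN] type[of "1/2" A_nd]
      unfolding A_minus_eq_orbits A_QN_eq_orbits A_nd_eq_orbits by force+
    have "A_minus \<noteq> A_QN" using types(1) disj(1) by (auto simp: type_planar_def)
    then have "\<not> unique_planar_type \<T> i j \<Omega> f" if "{A_minus, A_QN, A_nd} \<subseteq> \<T>" for \<T>
      using types(1,2) that unfolding unique_planar_type_def by blast
    then have "\<forall>\<T>. {A_minus, A_QN, A_nd} \<subseteq> \<T> \<longrightarrow> \<not> unique_planar_type \<T> i j \<Omega> f"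
      by simp
    moreover have "\<exists>X Y. X \<in> hyperplane_sections \<and> Y \<in> hyperplane_sections \<and> X \<noteq> Y \<and> ?C \<subseteq> X \<and> ?C \<subseteq> Y"
    proof (intro exI conjI)
      show "hyperplane_section (?z b 0) \<in> hyperplane_sections"
        "hyperplane_section (?z c 0) \<in> hyperplane_sections"
        using contained(1)[of 0] contained'(1) by (auto simp: hyperplane_sections_def)
      show "hyperplane_section (?z b 0) \<noteq> hyperplane_section (?z c 0)"
        by (rule hyperplane_section_plane_vec_neq[OF bc(3) nz(2)])
      show "?C \<subseteq> hyperplane_section (?z b 0)" "?C \<subseteq> hyperplane_section (?z c 0)"
        using contained(2)[of 0] contained'(2) by simp_all
    qed
    ultimately show ?thesis using types by (intro conjI)
  qed
  show ?thesis
    by (rule conjI[OF le3 conjI[OF impI[OF case3] impI[OF case2]]])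
qed

end
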